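(* Let $k\ge 1$ be an integer. If $G$ is an $\mathcal{F}'_k$-saturated graph with at least $k+1$ vertices, then $$\lambda_1(G)\ge \frac{k-2+\sqrt{k^2+4k-4}}{2},$$ with equality for $G=K_{k+1}^-$.
   Context: All graphs are finite and simple (no loops or multiedges). For a positive integer $k$, $\mathcal{F}'_k$ is the family of $k$-edge-connected graphs; a $k$-edge-connected graph is a graph with at least two vertices that remains connected after deletion of any set of fewer than $k$ edges (so a single vertex is not in $\mathcal{F}'_k$). Given a family $\mathcal{F}$ of graphs, a graph $G$ is $\mathcal{F}$-saturated if (1) no subgraph of $G$ belongs to $\mathcal{F}$, and (2) for every edge $e$ of the complement $\overline{G}$, the graph $G+e$ contains a subgraph belonging to $\mathcal{F}$. $K_{k+1}^-$ denotes the graph obtained from the complete graph $K_{k+1}$ by deleting one edge. The spectral radius $\lambda_1(G)$ is the largest eigenvalue of the adjacency matrix of $G$. *)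

theory Defs
  imports
    "Graph_Theory.Kuratowski"
    "Jordan_Normal_Form.Spectral_Radius"
begin

text \<open>
  A finite simple graph is an element of the library locale \<open>pair_graph\<close>: a finite loop-free
  symmetric digraph whose arcs are ordered pairs, so that an undirected edge \<open>{u, v}\<close> is present
  as the two arcs \<open>(u, v)\<close> and \<open>(v, u)\<close>. Since arcs come in pairs, edges are counted as unordered
  pairs, through the following set.
\<close>

definition edge_set :: "'a pair_pre_digraph \<Rightarrow> 'a set set" where
  "edge_set G = {{u, v} |u v. (u, v) \<in> parcs G}"

definition delete_edges :: "'a pair_pre_digraph \<Rightarrow> 'a set set \<Rightarrow> 'a pair_pre_digraph" where
  "delete_edges G F = \<lparr>pverts = pverts G, parcs = {(u, v) \<in> parcs G. {u, v} \<notin> F}\<rparr>"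

definition add_edge :: "'a pair_pre_digraph \<Rightarrow> 'a \<Rightarrow> 'a \<Rightarrow> 'a pair_pre_digraph" where
  "add_edge G u v = \<lparr>pverts = pverts G, parcs = parcs G \<union> {(u, v), (v, u)}\<rparr>"

text \<open>The name \<open>connected\<close> is qualified because of the topological notion of the same name.\<close>

definition k_edge_connected :: "nat \<Rightarrow> 'a pair_pre_digraph \<Rightarrow> bool" where
  "k_edge_connected k G \<longleftrightarrow>
     pair_graph G \<and> 2 \<le> card (pverts G) \<and>
     (\<forall>F. F \<subseteq> edge_set G \<and> card F < k \<longrightarrow>
        Digraph_Component.connected (with_proj (delete_edges G F)))"

definition edge_connected_family :: "nat \<Rightarrow> 'a pair_pre_digraph set" where
  "edge_connected_family k = {H. k_edge_connected k H}"

text \<open>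
  A subgraph of \<open>G\<close> has its vertices among those of \<open>G\<close>, so it suffices to have the members of the
  family whose vertices live in the vertex type of \<open>G\<close>. The members of the family are required to
  be graphs by the family itself; \<open>subgraph\<close> alone would also admit non-symmetric subdigraphs.
\<close>

definition saturated :: "'a pair_pre_digraph set \<Rightarrow> 'a pair_pre_digraph \<Rightarrow> bool" where
  "saturated \<F> G \<longleftrightarrow>
     pair_graph G \<and>
     (\<forall>H. subgraph (with_proj H) (with_proj G) \<longrightarrow> H \<notin> \<F>) \<and>
     (\<forall>u \<in> pverts G. \<forall>v \<in> pverts G. u \<noteq> v \<and> (u, v) \<notin> parcs G \<longrightarrow>
        (\<exists>H. subgraph (with_proj H) (with_proj (add_edge G u v)) \<and> H \<in> \<F>))"

definition complete_minus_edge :: "nat \<Rightarrow> 'a pair_pre_digraph \<Rightarrow> bool" where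
  "complete_minus_edge n G \<longleftrightarrow>
     (\<exists>K e. complete_digraph n (with_proj K) \<and> e \<in> edge_set K \<and> G = delete_edges K {e})"

definition adjacency_matrix :: "'a list \<Rightarrow> 'a pair_pre_digraph \<Rightarrow> real mat" where
  "adjacency_matrix vs G =
     mat (length vs) (length vs) (\<lambda>(i, j). if (vs ! i, vs ! j) \<in> parcs G then 1 else 0)"

text \<open>
  The largest eigenvalue of the adjacency matrix, for an arbitrary enumeration of the vertices; by
  \<open>spectrum_adjacency_matrix_cong\<close> below the choice does not matter. The adjacency matrix is
  real symmetric, so \<open>spectrum\<close>, the set of real eigenvalues, contains all of its eigenvalues.
\<close>

definition graph_spectral_radius :: "'a pair_pre_digraph \<Rightarrow> real" where
  "graph_spectral_radius G =
     Max (spectrum (adjacency_matrix (SOME vs. distinct vs \<and> set vs = pverts G) G))"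

lemma spectrum_adjacency_matrix_subset:
  assumes "distinct vs" "distinct ws" "set vs = set ws"
  shows "spectrum (adjacency_matrix vs G) \<subseteq> spectrum (adjacency_matrix ws G)"
proof
  fix x assume "x \<in> spectrum (adjacency_matrix vs G)"
  then obtain v where ev: "eigenvector (adjacency_matrix vs G) v x"
    by (auto simp: spectrum_def eigenvalue_def)
  define n where "n = length vs"
  have len: "length ws = n"
    using assms by (metis distinct_card n_def)
  have "\<forall>i<n. \<exists>j<n. vs ! j = ws ! i"
    using assms len by (metis in_set_conv_nth n_def)
  then obtain p where p: "\<And>i. i < n \<Longrightarrow> p i < n" "\<And>i. i < n \<Longrightarrow> vs ! p i = ws ! i"
    by metis
  have inj: "inj_on p {0..<n}"
    using p assms(2) len by (auto simp: inj_on_def) (metis nth_eq_iff_index_eq)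
  have bij: "bij_betw p {0..<n} {0..<n}"
    using inj p(1) by (simp add: bij_betw_def endo_inj_surj image_subset_iff)
  have v: "v \<in> carrier_vec n" "v \<noteq> 0\<^sub>v n" "adjacency_matrix vs G *\<^sub>v v = x \<cdot>\<^sub>v v"
    using ev by (auto simp: eigenvector_def adjacency_matrix_def n_def)
  define w where "w = vec n (\<lambda>i. v $ p i)"
  have "w \<noteq> 0\<^sub>v n"
  proof
    assume "w = 0\<^sub>v n"
    then have "v $ p i = 0" if "i < n" for i
      using that by (metis index_vec index_zero_vec(1) w_def)
    moreover have "\<exists>i<n. j = p i" if "j < n" for j
      using bij that unfolding bij_betw_def by (metis atLeastLessThan_iff image_iff le0)
    ultimately have "v $ j = 0" if "j < n" for j
      using that by blast
    then show False using v(1,2) by auto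
  qed
  moreover have "adjacency_matrix ws G *\<^sub>v w = x \<cdot>\<^sub>v w"
  proof (rule eq_vecI)
    fix i assume "i < dim_vec (x \<cdot>\<^sub>v w)"
    then have i: "i < n" by (simp add: w_def)
    let ?a = "\<lambda>j. (if (vs ! p i, vs ! j) \<in> parcs G then 1 else 0) * v $ j"
    have "(adjacency_matrix ws G *\<^sub>v w) $ i = (\<Sum>j = 0..<n. ?a (p j))"
      using i p by (simp add: adjacency_matrix_def scalar_prod_def len w_def)
    also have "\<dots> = (\<Sum>j = 0..<n. ?a j)"
      by (rule sum.reindex_bij_betw[OF bij])
    also have "\<dots> = (adjacency_matrix vs G *\<^sub>v v) $ p i"
      using i p(1)[OF i] v(1) by (simp add: adjacency_matrix_def scalar_prod_def n_def)
    also have "\<dots> = (x \<cdot>\<^sub>v w) $ i"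
      using i p(1)[OF i] v by (simp add: w_def)
    finally show "(adjacency_matrix ws G *\<^sub>v w) $ i = (x \<cdot>\<^sub>v w) $ i" .
  qed (simp add: adjacency_matrix_def len w_def)
  ultimately have "eigenvector (adjacency_matrix ws G) w x"
    by (simp add: eigenvector_def adjacency_matrix_def len w_def)
  then show "x \<in> spectrum (adjacency_matrix ws G)"
    by (auto simp: spectrum_def eigenvalue_def)
qed

lemma spectrum_adjacency_matrix_cong:
  assumes "distinct vs" "distinct ws" "set vs = set ws"
  shows "spectrum (adjacency_matrix vs G) = spectrum (adjacency_matrix ws G)"
  using assms by (intro equalityI spectrum_adjacency_matrix_subset) simp_all

end

theory Submission
  imports Defs "HOL-Analysis.Function_Topology"
begin

text \<open>
  Let \<open>\<rho>\<close> be the claimed bound; it is the larger root of \<open>t\<^sup>2 = (k - 2) t + 2 (k - 1)\<close>. This is the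
  quadratic satisfied by an eigenvalue of \<open>K\<^sub>k\<^sub>+\<^sub>1\<^sup>-\<close> whose eigenvector takes one value on the two
  non-adjacent vertices and another one on the remaining \<open>k - 1\<close> vertices. The eigenvector can be
  scaled to the value \<open>1\<close> on the former and a number \<open>c \<ge> 1\<close> on the latter
  (\<open>extremal_weights\<close>), and these two numbers are the only weights used below.

  For the lower bound, a saturated graph \<open>G\<close> with at least \<open>k + 1\<close> vertices is not complete, as a
  complete graph of that order is \<open>k\<close>-edge-connected. So two vertices \<open>u\<close>, \<open>v\<close> are not adjacent, and
  \<open>G + uv\<close> has a \<open>k\<close>-edge-connected subgraph \<open>H\<close>, which contains the edge \<open>uv\<close> since it is not a
  subgraph of \<open>G\<close>. All degrees of \<open>H\<close> are at least \<open>k\<close>. Hence, in \<open>H - uv \<subseteq> G\<close>, the vertices \<open>u\<close>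
  and \<open>v\<close> have at least \<open>k - 1\<close> neighbours and all others at least \<open>k\<close>, of which at most two are
  \<open>u\<close> or \<open>v\<close>. Now give \<open>u\<close> and \<open>v\<close> weight \<open>1\<close>, the other vertices of \<open>H\<close> weight \<open>c\<close>, and those
  outside \<open>H\<close> weight \<open>0\<close>. These degree bounds say that the weights of the neighbours of
  each vertex \<open>w\<close> add up to at least \<open>\<rho>\<close> times the weight of \<open>w\<close>. By the Rayleigh principle, such a
  weighting forces the largest eigenvalue to be at least \<open>\<rho>\<close> (\<open>le_graph_spectral_radius\<close>).

  In \<open>K\<^sub>k\<^sub>+\<^sub>1\<^sup>-\<close> itself all vertices have positive weight and the inequalities are equalities. A
  positive weighting with the reverse inequalities bounds all eigenvalues from above
  (\<open>graph_spectral_radius_le\<close>). That \<open>K\<^sub>k\<^sub>+\<^sub>1\<^sup>-\<close> is saturated follows again from the minimum degree: a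
  \<open>k\<close>-edge-connected subgraph would need all \<open>k + 1\<close> vertices, two of which have degree \<open>k - 1\<close>.
\<close>

section \<open>The largest eigenvalue of a symmetric real kernel on a finite set\<close>

text \<open>
  The variational principle: the quadratic form attains a maximum \<open>M\<close> on the unit sphere, so
  \<open>M I - a\<close> is positive semidefinite and its form vanishes at the maximiser \<open>f\<close>. A positive
  semidefinite form that vanishes at \<open>f\<close> has \<open>f\<close> in its kernel, that is, \<open>f\<close> is an eigenvector for \<open>M\<close>.
  Functions on the index type with the product topology stand in for vectors, because the
  size of \<open>V\<close> is not fixed by a type.
\<close>

lemma symmetric_kernel_max_eigenvalue:
  fixes a :: "'a \<Rightarrow> 'a \<Rightarrow> real"
  assumes "finite V" "V \<noteq> {}" and sym: "\<And>i j. i \<in> V \<Longrightarrow> j \<in> V \<Longrightarrow> a i j = a j i"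
  obtains M f where "\<exists>i\<in>V. f i \<noteq> 0" "\<And>i. i \<in> V \<Longrightarrow> (\<Sum>j\<in>V. a i j * f j) = M * f i"
    "\<And>x. (\<Sum>i\<in>V. x i * (\<Sum>j\<in>V. a i j * x j)) \<le> M * (\<Sum>i\<in>V. (x i)\<^sup>2)"
proof -
  define Q where "Q = (\<lambda>x. \<Sum>i\<in>V. x i * (\<Sum>j\<in>V. a i j * x j))"
  define N where "N = (\<lambda>x :: 'a \<Rightarrow> real. \<Sum>i\<in>V. (x i)\<^sup>2)"
  \<comment> \<open>The unit sphere on \<open>V\<close> is compact only if the coordinates outside \<open>V\<close> are bounded as well.\<close>
  define Box where "Box = (\<Pi>\<^sub>E i\<in>UNIV. if i \<in> V then {- 1..1::real} else {0})"
  define S where "S = Box \<inter> {x. N x = 1}"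
  have contN: "continuous_on UNIV N" and contQ: "continuous_on UNIV Q"
    unfolding N_def Q_def
    by (auto intro!: continuous_intros continuous_on_product_coordinates)
  have "compactin (product_topology (\<lambda>i. euclidean) UNIV) Box"
    unfolding Box_def compactin_PiE by auto
  then have "compact Box"
    by (simp add: euclidean_product_topology)
  moreover have "closed {x. N x = 1}"
    using contN by (intro closed_Collect_eq) simp_all
  ultimately have "compact S"
    unfolding S_def by (rule compact_Int_closed)
  have normalize: "(\<lambda>i. if i \<in> V then x i / sqrt (N x) else 0) \<in> S" if "N x > 0" for x
  proof -
    have "(x i)\<^sup>2 \<le> N x" if "i \<in> V" for i
      unfolding N_def by (rule member_le_sum) (use that assms in auto)
    then have "\<bar>x i\<bar> \<le> sqrt (N x)" if "i \<in> V" for i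
      using that by (simp add: real_le_rsqrt)
    then have "- 1 \<le> x i / sqrt (N x) \<and> x i / sqrt (N x) \<le> 1" if "i \<in> V" for i
      using that \<open>N x > 0\<close> by (fastforce simp: field_simps abs_le_iff)
    moreover have "N (\<lambda>i. if i \<in> V then x i / sqrt (N x) else 0) = (\<Sum>i\<in>V. (x i)\<^sup>2 / N x)"
      using that by (simp add: N_def power_divide sum_nonneg)
    moreover have "\<dots> = 1"
      using that by (simp flip: sum_divide_distrib add: N_def)
    ultimately show ?thesis
      by (auto simp: S_def Box_def)
  qed
  have "N (\<lambda>_. 1) > 0"
    using assms by (simp add: N_def card_gt_0_iff)
  then have "S \<noteq> {}"
    using normalize by blast
  then obtain f where f: "f \<in> S" and max: "\<And>x. x \<in> S \<Longrightarrow> Q x \<le> Q f"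
    using continuous_attains_sup[OF \<open>compact S\<close>, of Q] contQ continuous_on_subset by blast
  define M where "M = Q f"
  have Nf: "N f = 1"
    using f by (simp add: S_def)
  have bound: "Q x \<le> M * N x" for x
  proof (cases "N x > 0")
    case True
    define s where "s = sqrt (N x)"
    have s: "s > 0" "s\<^sup>2 = N x"
      using True by (simp_all add: s_def)
    let ?y = "\<lambda>i. if i \<in> V then x i / s else 0"
    have "Q ?y = (\<Sum>i\<in>V. x i * (\<Sum>j\<in>V. a i j * x j) / s\<^sup>2)"
      unfolding Q_def
      by (intro sum.cong) (auto simp: power2_eq_square sum_divide_distrib sum_distrib_left
          intro!: sum.cong)
    also have "\<dots> = Q x / N x"
      by (simp add: Q_def s sum_divide_distrib)
    finally have "Q x = N x * Q ?y"
      using True by simp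
    also have "\<dots> \<le> N x * Q f"
      using max[OF normalize[OF True], folded s_def] True by (intro mult_left_mono) simp_all
    finally show ?thesis
      by (simp add: M_def mult.commute)
  next
    case False
    have "N x \<ge> 0" by (simp add: N_def sum_nonneg)
    then have "\<forall>i\<in>V. x i = 0"
      using False assms by (simp add: N_def sum_nonneg_eq_0_iff)
    then show ?thesis by (simp add: Q_def N_def)
  qed
  define L where "L = (\<lambda>x i. M * x i - (\<Sum>j\<in>V. a i j * x j))"
  define B where "B = (\<lambda>x y. \<Sum>i\<in>V. x i * L y i)"
  have B_self: "B x x = M * N x - Q x" for x
    by (simp add: B_def L_def N_def Q_def algebra_simps power2_eq_square sum_subtractf sum_distrib_left)
  have B_sym: "B x y = B y x" for x y
  proof -
    have "(\<Sum>i\<in>V. x i * (\<Sum>j\<in>V. a i j * y j)) = (\<Sum>i\<in>V. \<Sum>j\<in>V. x i * a i j * y j)"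
      by (simp add: sum_distrib_left mult_ac)
    also have "\<dots> = (\<Sum>j\<in>V. \<Sum>i\<in>V. x i * a i j * y j)"
      by (rule sum.swap)
    also have "\<dots> = (\<Sum>j\<in>V. y j * (\<Sum>i\<in>V. a j i * x i))"
      by (simp add: sum_distrib_left mult_ac sym cong: sum.cong)
    finally show ?thesis
      by (simp add: B_def L_def right_diff_distrib sum_subtractf mult_ac)
  qed
  have eigen: "L f i = 0" if "i \<in> V" for i
  proof (rule ccontr)
    assume "L f i \<noteq> 0"
    define e where "e = (\<lambda>j. if j = i then 1 else 0 :: real)"
    have b: "B e f = L f i"
      using that assms(1) by (simp add: B_def e_def if_distrib[of "\<lambda>x. x * _"] cong: if_cong)
    \<comment> \<open>Along the direction \<open>e\<close> the form is \<open>2 t B e f + t\<^sup>2 B e e\<close>, which this \<open>t\<close> makes negative;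
      the summand \<open>1\<close> avoids a division by zero when \<open>B e e = 0\<close>.\<close>
    define t where "t = - B e f / (B e e + 1)"
    have pos: "B x x \<ge> 0" for x
      using bound[of x] by (simp add: B_self)
    have L_add: "L (\<lambda>j. f j + t * e j) l = L f l + t * L e l" for l
      by (simp add: L_def algebra_simps sum.distrib sum_distrib_left)
    have "B (\<lambda>j. f j + t * e j) (\<lambda>j. f j + t * e j)
        = B f f + t * B e f + t * B f e + t\<^sup>2 * B e e"
      unfolding B_def L_add
      by (simp add: algebra_simps sum.distrib sum_distrib_left power2_eq_square)
    also have "\<dots> = 2 * t * B e f + t\<^sup>2 * B e e"
      using B_sym[of f e] Nf by (simp add: B_self M_def)
    also have "\<dots> = - t\<^sup>2 * (B e e + 2)"
    proof -
      have "B e f = - t * (B e e + 1)"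
        using pos[of e] by (simp add: t_def)
      then show ?thesis
        by (simp only:) (simp add: power2_eq_square algebra_simps)
    qed
    also have "\<dots> < 0"
      using pos[of e] b \<open>L f i \<noteq> 0\<close> by (simp add: t_def)
    finally show False
      using pos[of "\<lambda>j. f j + t * e j"] by simp
  qed
  have nz: "\<exists>i\<in>V. f i \<noteq> 0"
    using Nf by (auto simp: N_def intro: ccontr)
  have eq: "(\<Sum>j\<in>V. a i j * f j) = M * f i" if "i \<in> V" for i
    using eigen[OF that] by (simp add: L_def)
  show ?thesis
    by (rule that[OF nz eq bound[unfolded Q_def N_def]])
qed

section \<open>Eigenvalues of a graph as weightings of its vertices\<close>

definition vertex_eigenfunction :: "'a pair_pre_digraph \<Rightarrow> real \<Rightarrow> ('a \<Rightarrow> real) \<Rightarrow> bool" where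
  "vertex_eigenfunction G \<theta> f \<longleftrightarrow> (\<exists>u\<in>pverts G. f u \<noteq> 0) \<and>
     (\<forall>u\<in>pverts G. (\<Sum>v\<in>parcs G `` {u}. f v) = \<theta> * f u)"

text \<open>
  This frees eigenvalues from the enumeration of the vertices: an eigenvector of the matrix is read
  as a weighting of the vertices, and the matrix acts on it by summation over neighbours.
\<close>

lemma spectrum_adjacency_matrix_eq:
  fixes G :: "'a pair_pre_digraph"
  assumes "distinct vs" "set vs = pverts G" and wf: "\<And>u. parcs G `` {u} \<subseteq> pverts G"
  shows "spectrum (adjacency_matrix vs G) = {\<theta>. \<exists>f. vertex_eigenfunction G \<theta> f}"
proof -
  define n where "n = length vs"
  have bij: "bij_betw (\<lambda>i. vs ! i) {0..<n} (pverts G)"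
    using assms by (simp add: bij_betw_nth n_def lessThan_atLeast0)
  have mult: "(adjacency_matrix vs G *\<^sub>v w) $ i = (\<Sum>v\<in>parcs G `` {vs ! i}. f v)"
    if w: "w = vec n (\<lambda>i. f (vs ! i))" and i: "i < n" for w f i
  proof -
    have "(adjacency_matrix vs G *\<^sub>v w) $ i
        = (\<Sum>j = 0..<n. (if (vs ! i, vs ! j) \<in> parcs G then f (vs ! j) else 0))"
      using i by (auto simp: w adjacency_matrix_def scalar_prod_def n_def intro!: sum.cong)
    also have "\<dots> = (\<Sum>v\<in>pverts G. if (vs ! i, v) \<in> parcs G then f v else 0)"
      by (rule sum.reindex_bij_betw[OF bij])
    also have "\<dots> = (\<Sum>v\<in>{v \<in> pverts G. (vs ! i, v) \<in> parcs G}. f v)"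
      using assms(2) by (intro sum.inter_filter[symmetric]) (metis List.finite_set)
    also have "{v \<in> pverts G. (vs ! i, v) \<in> parcs G} = parcs G `` {vs ! i}"
      using wf by auto
    finally show ?thesis .
  qed
  have eigen: "eigenvector (adjacency_matrix vs G) w \<theta> \<longleftrightarrow> vertex_eigenfunction G \<theta> f"
    if w: "w = vec n (\<lambda>i. f (vs ! i))" for w f \<theta>
  proof -
    have ex: "(\<exists>u\<in>pverts G. P u) \<longleftrightarrow> (\<exists>i<n. P (vs ! i))"
      and all: "(\<forall>u\<in>pverts G. P u) \<longleftrightarrow> (\<forall>i<n. P (vs ! i))" for P
      using assms(2) by (auto simp: n_def in_set_conv_nth Bex_def Ball_def)
        (metis in_set_conv_nth)+
    have "w \<noteq> 0\<^sub>v n \<longleftrightarrow> (\<exists>u\<in>pverts G. f u \<noteq> 0)"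
      unfolding ex by (auto simp: w vec_eq_iff)
    moreover have "adjacency_matrix vs G *\<^sub>v w = \<theta> \<cdot>\<^sub>v w \<longleftrightarrow>
        (\<forall>u\<in>pverts G. (\<Sum>v\<in>parcs G `` {u}. f v) = \<theta> * f u)"
      unfolding all using mult[OF w]
      by (auto simp: vec_eq_iff w) (simp_all add: adjacency_matrix_def n_def)
    ultimately show ?thesis
      by (simp add: vertex_eigenfunction_def eigenvector_def w adjacency_matrix_def n_def)
  qed
  have "(\<exists>w. eigenvector (adjacency_matrix vs G) w \<theta>) \<longleftrightarrow> (\<exists>f. vertex_eigenfunction G \<theta> f)" for \<theta>
  proof
    assume "\<exists>w. eigenvector (adjacency_matrix vs G) w \<theta>"
    then obtain w where w: "eigenvector (adjacency_matrix vs G) w \<theta>" ..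
    define f where "f = (\<lambda>u. w $ the_inv_into {0..<n} (\<lambda>i. vs ! i) u)"
    have "w = vec n (\<lambda>i. f (vs ! i))"
      using w the_inv_into_f_f[OF bij_betw_imp_inj_on[OF bij]]
      by (auto simp: f_def eigenvector_def adjacency_matrix_def n_def)
    with w eigen show "\<exists>f. vertex_eigenfunction G \<theta> f"
      by blast
  qed (use eigen in blast)
  then show ?thesis
    by (auto simp: spectrum_def eigenvalue_def)
qed

lemma neighbours_subset_pverts: "pair_graph G \<Longrightarrow> parcs G `` {u} \<subseteq> pverts G"
  using pair_wf_digraph.in_arcsD2 by (fastforce simp: pair_graph_def pair_digraph_def pair_fin_digraph_def)

lemma graph_spectral_radius_eq_Max:
  assumes "pair_graph G"
  shows "finite {\<theta>. \<exists>f. vertex_eigenfunction G \<theta> f}"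
    and "graph_spectral_radius G = Max {\<theta>. \<exists>f. vertex_eigenfunction G \<theta> f}"
proof -
  interpret pair_graph G by fact
  define vs where "vs = (SOME vs. distinct vs \<and> set vs = pverts G)"
  have "\<exists>vs. distinct vs \<and> set vs = pverts G"
    using finite_distinct_list[OF pair_finite_verts] by blast
  then have vs: "distinct vs" "set vs = pverts G"
    unfolding vs_def by (metis (mono_tags, lifting) someI_ex)+
  have eq: "spectrum (adjacency_matrix vs G) = {\<theta>. \<exists>f. vertex_eigenfunction G \<theta> f}"
    using vs by (rule spectrum_adjacency_matrix_eq) (rule neighbours_subset_pverts[OF assms])
  have "finite (spectrum (adjacency_matrix vs G))"
    by (rule card_finite_spectrum[of _ "length vs"]) (simp add: adjacency_matrix_def)
  then show "finite {\<theta>. \<exists>f. vertex_eigenfunction G \<theta> f}"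
    by (simp add: eq)
  show "graph_spectral_radius G = Max {\<theta>. \<exists>f. vertex_eigenfunction G \<theta> f}"
    unfolding graph_spectral_radius_def vs_def[symmetric] eq ..
qed

text \<open>
  The value \<open>M\<close> of the variational principle is an eigenvalue, and its inequality applied to the
  eigenfunctions shows that no eigenvalue exceeds it. In particular there are eigenvalues, which makes
  the maximum in the definition of the spectral radius meaningful.
\<close>

lemma graph_spectral_radius_eigenfunction:
  assumes "pair_graph G" "pverts G \<noteq> {}"
  shows "\<exists>f. vertex_eigenfunction G (graph_spectral_radius G) f"
    and "(\<Sum>u\<in>pverts G. x u * (\<Sum>v\<in>parcs G `` {u}. x v))
      \<le> graph_spectral_radius G * (\<Sum>u\<in>pverts G. (x u)\<^sup>2)"
proof -
  interpret pair_graph G by fact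
  define a where "a = (\<lambda>u v. if (u, v) \<in> parcs G then 1 else 0 :: real)"
  have a: "(\<Sum>v\<in>pverts G. a u v * x v) = (\<Sum>v\<in>parcs G `` {u}. x v)" for u x
  proof -
    have "(\<Sum>v\<in>pverts G. a u v * x v) = (\<Sum>v\<in>{v \<in> pverts G. (u, v) \<in> parcs G}. x v)"
      unfolding sum.inter_filter[OF pair_finite_verts] by (intro sum.cong) (auto simp: a_def)
    also have "{v \<in> pverts G. (u, v) \<in> parcs G} = parcs G `` {u}"
      using neighbours_subset_pverts[OF assms(1)] by auto
    finally show ?thesis .
  qed
  obtain M f where f: "vertex_eigenfunction G M f"
    and bound: "\<And>x. (\<Sum>u\<in>pverts G. x u * (\<Sum>v\<in>parcs G `` {u}. x v)) \<le> M * (\<Sum>u\<in>pverts G. (x u)\<^sup>2)"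
  proof (rule symmetric_kernel_max_eigenvalue[of "pverts G" a, unfolded a])
    show "a u v = a v u" for u v
      using arcs_symmetric by (auto simp: a_def)
  qed (use pair_finite_verts assms(2) in \<open>auto simp: vertex_eigenfunction_def\<close>)
  have "\<theta> \<le> M" if g: "vertex_eigenfunction G \<theta> g" for \<theta> g
  proof -
    obtain w where "w \<in> pverts G" "g w \<noteq> 0"
      using g by (auto simp: vertex_eigenfunction_def)
    then have "0 < (\<Sum>u\<in>pverts G. (g u)\<^sup>2)"
      using pair_finite_verts by (intro sum_pos2[of _ w]) auto
    moreover have "\<theta> * (\<Sum>u\<in>pverts G. (g u)\<^sup>2) = (\<Sum>u\<in>pverts G. g u * (\<theta> * g u))"
      by (simp add: sum_distrib_left power2_eq_square mult_ac)
    then have "\<theta> * (\<Sum>u\<in>pverts G. (g u)\<^sup>2) \<le> M * (\<Sum>u\<in>pverts G. (g u)\<^sup>2)"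
      using bound[of g] g by (simp add: vertex_eigenfunction_def)
    ultimately show ?thesis by simp
  qed
  then have "graph_spectral_radius G = M"
    unfolding graph_spectral_radius_eq_Max(2)[OF assms(1)]
    using f graph_spectral_radius_eq_Max(1)[OF assms(1)] by (intro Max_eqI) auto
  with f bound show "\<exists>f. vertex_eigenfunction G (graph_spectral_radius G) f"
    and "(\<Sum>u\<in>pverts G. x u * (\<Sum>v\<in>parcs G `` {u}. x v))
      \<le> graph_spectral_radius G * (\<Sum>u\<in>pverts G. (x u)\<^sup>2)"
    by auto
qed

text \<open>
  Multiplying the hypothesis by the weight of \<open>u\<close> and summing over \<open>u\<close> bounds the Rayleigh quotient
  of \<open>x\<close> from below. The weights may vanish at some vertices, so that it suffices to know the
  neighbourhoods inside a subgraph.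
\<close>

lemma le_graph_spectral_radius:
  assumes "pair_graph G" and nonneg: "\<And>u. u \<in> pverts G \<Longrightarrow> x u \<ge> 0"
    and nz: "\<exists>u\<in>pverts G. x u \<noteq> 0"
    and sub: "\<And>u. u \<in> pverts G \<Longrightarrow> \<mu> * x u \<le> (\<Sum>v\<in>parcs G `` {u}. x v)"
  shows "\<mu> \<le> graph_spectral_radius G"
proof -
  interpret pair_graph G by fact
  have "\<mu> * (\<Sum>u\<in>pverts G. (x u)\<^sup>2) = (\<Sum>u\<in>pverts G. x u * (\<mu> * x u))"
    by (simp add: sum_distrib_left power2_eq_square mult_ac)
  also have "\<dots> \<le> (\<Sum>u\<in>pverts G. x u * (\<Sum>v\<in>parcs G `` {u}. x v))"
    by (intro sum_mono mult_left_mono sub nonneg)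
  also have "\<dots> \<le> graph_spectral_radius G * (\<Sum>u\<in>pverts G. (x u)\<^sup>2)"
    using nz by (intro graph_spectral_radius_eigenfunction[OF assms(1)]) blast
  finally have "\<mu> * (\<Sum>u\<in>pverts G. (x u)\<^sup>2) \<le> graph_spectral_radius G * (\<Sum>u\<in>pverts G. (x u)\<^sup>2)" .
  moreover obtain w where "w \<in> pverts G" "x w \<noteq> 0"
    using nz by blast
  then have "0 < (\<Sum>u\<in>pverts G. (x u)\<^sup>2)"
    using pair_finite_verts by (intro sum_pos2[of _ w]) auto
  ultimately show ?thesis by simp
qed

text \<open>
  Compare an eigenfunction \<open>f\<close> with \<open>z\<close> at a vertex \<open>w\<close> where \<open>\<bar>f\<bar> / z\<close> is largest, equal to \<open>r\<close> say: the
  neighbours of \<open>w\<close> have \<open>\<bar>f\<bar> \<le> r z\<close>, so the eigenvalue equation at \<open>w\<close> is bounded by \<open>r\<close> times the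
  inequality for \<open>z\<close>.
\<close>

lemma graph_spectral_radius_le:
  assumes "pair_graph G" "pverts G \<noteq> {}" and pos: "\<And>u. u \<in> pverts G \<Longrightarrow> z u > 0"
    and super: "\<And>u. u \<in> pverts G \<Longrightarrow> (\<Sum>v\<in>parcs G `` {u}. z v) \<le> \<mu> * z u"
  shows "graph_spectral_radius G \<le> \<mu>"
proof -
  interpret pair_graph G by fact
  let ?\<theta> = "graph_spectral_radius G"
  obtain f where f: "\<exists>u\<in>pverts G. f u \<noteq> 0"
    "\<And>u. u \<in> pverts G \<Longrightarrow> (\<Sum>v\<in>parcs G `` {u}. f v) = ?\<theta> * f u"
    using graph_spectral_radius_eigenfunction(1)[OF assms(1,2)]
    by (auto simp: vertex_eigenfunction_def)
  define r where "r = Max ((\<lambda>u. \<bar>f u\<bar> / z u) ` pverts G)"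
  have "r \<in> (\<lambda>u. \<bar>f u\<bar> / z u) ` pverts G"
    unfolding r_def by (rule Max_in) (use assms(2) pair_finite_verts in auto)
  then obtain w where w: "w \<in> pverts G" "r = \<bar>f w\<bar> / z w"
    by blast
  have r: "\<bar>f u\<bar> \<le> r * z u" if "u \<in> pverts G" for u
  proof -
    have "\<bar>f u\<bar> / z u \<le> r"
      unfolding r_def using that pair_finite_verts by simp
    then show ?thesis using pos[OF that] by (simp add: field_simps)
  qed
  have fw: "\<bar>f w\<bar> = r * z w"
    using w pos[OF w(1)] by simp
  have "r > 0"
  proof -
    obtain u where "u \<in> pverts G" "f u \<noteq> 0" using f(1) by blast
    then have "0 < r * z u" using r[of u] by simp
    then show ?thesis using pos[OF \<open>u \<in> pverts G\<close>] by (simp add: zero_less_mult_iff)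
  qed
  have "?\<theta> * \<bar>f w\<bar> \<le> \<bar>?\<theta> * f w\<bar>"
    by (simp add: abs_mult mult_right_mono)
  also have "\<dots> \<le> (\<Sum>v\<in>parcs G `` {w}. \<bar>f v\<bar>)"
    using f(2)[OF w(1)] sum_abs by metis
  also have "\<dots> \<le> (\<Sum>v\<in>parcs G `` {w}. r * z v)"
    using neighbours_subset_pverts[OF assms(1)] r by (intro sum_mono) blast
  also have "\<dots> \<le> r * (\<mu> * z w)"
    using super[OF w(1)] \<open>r > 0\<close> by (simp flip: sum_distrib_left)
  also have "\<dots> = \<mu> * \<bar>f w\<bar>"
    by (simp add: fw)
  finally show ?thesis
    using fw \<open>r > 0\<close> pos[OF w(1)] by simp
qed

section \<open>Edge-connectivity: minimum degree and complete graphs\<close>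

text \<open>Deleting all edges at a vertex isolates it, and there is at least one other vertex.\<close>

lemma k_edge_connected_degree:
  assumes "k_edge_connected k H" "w \<in> pverts H"
  shows "k \<le> card (parcs H `` {w})"
proof (rule ccontr)
  assume less: "\<not> k \<le> card (parcs H `` {w})"
  from assms interpret pair_graph H by (simp add: k_edge_connected_def)
  define F where "F = (\<lambda>v. {w, v}) ` (parcs H `` {w})"
  have "finite (parcs H `` {w})"
    using neighbours_subset_pverts[of H w] pair_graph pair_finite_verts finite_subset by blast
  then have "card F < k"
    using less card_image_le[of "parcs H `` {w}" "\<lambda>v. {w, v}"] by (simp add: F_def)
  moreover have "F \<subseteq> edge_set H"
    by (auto simp: F_def edge_set_def)
  ultimately have conn: "Digraph_Component.connected (with_proj (delete_edges H F))"
    using assms(1) by (simp add: k_edge_connected_def)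
  have "pverts H \<noteq> {w}"
    using assms(1) by (auto simp: k_edge_connected_def)
  then obtain w' where w': "w' \<in> pverts H" "w' \<noteq> w"
    using assms(2) by blast
  have "w \<rightarrow>\<^sup>*\<^bsub>with_proj (mk_symmetric (with_proj (delete_edges H F)))\<^esub> w'"
    using conn w' assms(2)
    by (simp add: Digraph_Component.connected_def strongly_connected_def delete_edges_def)
  then have "(w, w') \<in> (parcs (mk_symmetric (with_proj (delete_edges H F))))\<^sup>*"
    using reachable_rtranclI by fastforce
  then obtain y where "(w, y) \<in> parcs (mk_symmetric (with_proj (delete_edges H F)))"
    using w'(2) by (metis converse_rtranclE)
  then have "((w, y) \<in> parcs H \<or> (y, w) \<in> parcs H) \<and> {w, y} \<notin> F"
    by (auto simp: parcs_mk_symmetric delete_edges_def insert_commute)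
  then show False
    using arcs_symmetric by (auto simp: F_def)
qed

lemma complete_k_edge_connected:
  assumes "finite (pverts H)" "k + 1 \<le> card (pverts H)" "k \<ge> 1"
    and complete: "parcs H = {(u, v). u \<in> pverts H \<and> v \<in> pverts H \<and> u \<noteq> v}"
  shows "k_edge_connected k H"
proof -
  have "complete_digraph (card (pverts H)) (with_proj H)"
    using assms(1) complete by (auto simp: complete_digraph_pair_def)
  then interpret pair_graph H by (rule pair_graphI_complete)
  have "Digraph_Component.connected (with_proj (delete_edges H F))"
    if F: "F \<subseteq> edge_set H" "card F < k" for F
  proof -
    let ?D = "mk_symmetric (with_proj (delete_edges H F))"
    have D: "parcs ?D = {(u, v) \<in> parcs H. {u, v} \<notin> F}"
      using arcs_symmetric by (auto simp: parcs_mk_symmetric delete_edges_def insert_commute)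
    have V: "pverts ?D = pverts H"
      by (simp add: delete_edges_def)
    interpret D: pair_wf_digraph ?D
      using V D wellformed' by unfold_locales auto
    have finF: "finite F"
    proof (rule finite_subset[OF F(1)])
      have "edge_set H = (\<lambda>(u, v). {u, v}) ` parcs H"
        by (auto simp: edge_set_def)
      then show "finite (edge_set H)"
        using pair_finite_arcs by simp
    qed
    have "u \<rightarrow>\<^sup>*\<^bsub>with_proj ?D\<^esub> v" if uv: "u \<in> pverts H" "v \<in> pverts H" for u v
    proof (cases "u = v")
      case False
      \<comment> \<open>The paths \<open>u, w, v\<close> for \<open>w \<noteq> u\<close> (for \<open>w = v\<close> it is the single edge) are
        \<open>k\<close> or more and pairwise edge-disjoint, so \<open>F\<close> misses one of them.\<close>
      have "\<exists>w\<in>pverts H - {u}. {u, w} \<notin> F \<and> {w, v} \<notin> F"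
      proof (rule ccontr)
        assume neg: "\<not> ?thesis"
        define g where "g = (\<lambda>w. if {u, w} \<in> F then {u, w} else {w, v})"
        have "g ` (pverts H - {u}) \<subseteq> F"
          using neg by (auto simp: g_def)
        moreover have "inj_on g (pverts H - {u})"
          using False by (auto simp: inj_on_def g_def doubleton_eq_iff split: if_splits)
        ultimately have "card (pverts H - {u}) \<le> card F"
          using finF by (metis card_image card_mono)
        then show False
          using F(2) assms(2) uv(1) by simp
      qed
      then obtain w where w: "w \<in> pverts H" "w \<noteq> u" "{u, w} \<notin> F" "{w, v} \<notin> F"
        by blast
      then have "(u, w) \<in> parcs ?D"
        using uv by (simp add: D complete)
      moreover have "w = v \<or> (w, v) \<in> parcs ?D"
        using w uv by (auto simp: D complete)
      ultimately show ?thesis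
        using D.reachable_adjI D.reachable_trans by (metis with_proj_simps(3))
    qed (use that V in auto)
    then show ?thesis
      using assms by (auto simp: Digraph_Component.connected_def strongly_connected_def V[simplified])
  qed
  then show ?thesis
    using assms pair_graph by (simp add: k_edge_connected_def)
qed

section \<open>The largest eigenvalue of a complete graph minus an edge\<close>

text \<open>
  The two equations are the eigenvalue equations of \<open>K\<^sub>k\<^sub>+\<^sub>1\<^sup>-\<close> for the weight \<open>1\<close> on the two non-adjacent
  vertices and \<open>c\<close> on the others: one of the others sees \<open>k - 2\<close> weights \<open>c\<close> and two weights \<open>1\<close>, and a
  non-adjacent vertex sees \<open>k - 1\<close> weights \<open>c\<close>. The inequality \<open>c \<ge> 1\<close> is what makes a neighbour among
  the others count at least as much as one of the two.
\<close>

lemma extremal_weights: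
  fixes k :: nat
  assumes "k \<ge> 1"
  defines "\<rho> \<equiv> (real k - 2 + sqrt (real k ^ 2 + 4 * real k - 4)) / 2"
  obtains c where "c \<ge> 1" "\<rho> * c = (real k - 2) * c + 2" "(real k - 1) * c = \<rho>"
proof -
  define s where "s = sqrt (real k ^ 2 + 4 * real k - 4)"
  have "real k ^ 2 + 4 * real k - 4 \<ge> 1"
    using assms(1) by (smt (verit) of_nat_1 of_nat_mono one_le_power)
  then have s: "s\<^sup>2 = real k ^ 2 + 4 * real k - 4" "s \<ge> 0"
    by (simp_all add: s_def)
  have "real k - 2 < s"
  proof (cases "k = 1")
    case False
    then have "(real k - 2)\<^sup>2 < s\<^sup>2"
      using s(1) assms(1) by (simp add: power2_diff)
    then show ?thesis
      using s(2) by (rule power2_less_imp_less)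
  qed (use s(2) in simp)
  \<comment> \<open>The first equation forces \<open>c = 2 / (\<rho> - (k - 2)) = 4 / d\<close>. Unlike \<open>\<rho> / (k - 1)\<close>, which the
    second equation suggests, this is also right for \<open>k = 1\<close>.\<close>
  define d where "d = s - (real k - 2)"
  have d: "0 < d" "\<rho> = real k - 2 + d / 2"
    using \<open>real k - 2 < s\<close> by (simp_all add: d_def \<rho>_def s_def field_simps)
  have "s\<^sup>2 \<le> (real k + 2)\<^sup>2"
    using s(1) by (simp add: power2_sum)
  then have "s \<le> real k + 2"
    by (rule power2_le_imp_le) simp
  then have "d \<le> 4"
    by (simp add: d_def)
  have "\<rho> * d = (s\<^sup>2 - (real k - 2)\<^sup>2) / 2"
    unfolding d(2) by (simp add: d_def field_simps power2_eq_square)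
  then have "\<rho> * d = 4 * (real k - 1)"
    using s(1) by (simp add: power2_diff)
  show ?thesis
  proof (rule that[of "4 / d"])
    show "4 / d \<ge> 1"
      using \<open>d \<le> 4\<close> d(1) by simp
    show "\<rho> * (4 / d) = (real k - 2) * (4 / d) + 2"
      unfolding d(2) using d(1) by (simp add: field_simps)
    show "(real k - 1) * (4 / d) = \<rho>"
      using \<open>\<rho> * d = 4 * (real k - 1)\<close> d(1) by (simp add: field_simps)
  qed
qed

section \<open>Saturated graphs\<close>

text \<open>
  A \<open>k\<close>-edge-connected graph minus one edge \<open>uv\<close> lies inside \<open>G\<close>; its degrees dominate those of \<open>K\<^sub>k\<^sub>+\<^sub>1\<^sup>-\<close>
  closely enough for the weights of the latter to be a subsolution on \<open>G\<close>.
\<close>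

lemma saturated_spectral_bound:
  fixes G :: "'a pair_pre_digraph"
  assumes "k \<ge> 1" and sat: "saturated (edge_connected_family k) G"
    and card: "card (pverts G) \<ge> k + 1"
  shows "(real k - 2 + sqrt (real k ^ 2 + 4 * real k - 4)) / 2 \<le> graph_spectral_radius G"
proof -
  from sat interpret pair_graph G by (simp add: saturated_def)
  have G: "pair_graph G" ..
  have no_sub: "\<not> k_edge_connected k H" if "subgraph (with_proj H) (with_proj G)" for H
    using sat that by (auto simp: saturated_def edge_connected_family_def)
  have "\<not> k_edge_connected k G"
    by (rule no_sub) (use wf_digraph in \<open>simp add: subgraph_def compatible_def\<close>)
  then have "parcs G \<noteq> {(u, v). u \<in> pverts G \<and> v \<in> pverts G \<and> u \<noteq> v}"
    using complete_k_edge_connected[of G k] assms pair_finite_verts by blast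
  then obtain u v where uv: "u \<in> pverts G" "v \<in> pverts G" "u \<noteq> v" "(u, v) \<notin> parcs G"
    using wellformed' no_loops' by blast
  then obtain H where sub: "subgraph (with_proj H) (with_proj (add_edge G u v))"
    and H: "k_edge_connected k H"
    using sat by (fastforce simp: saturated_def edge_connected_family_def)
  interpret H: pair_graph H
    using H by (simp add: k_edge_connected_def)
  have VH: "pverts H \<subseteq> pverts G" and EH: "parcs H \<subseteq> parcs G \<union> {(u, v), (v, u)}"
    using sub by (auto simp: subgraph_def add_edge_def)
  have "(u, v) \<in> parcs H"
  proof (rule ccontr)
    assume "(u, v) \<notin> parcs H"
    then have "parcs H \<subseteq> parcs G"
      using EH H.arcs_symmetric by blast
    then have "subgraph (with_proj H) (with_proj G)"
      using VH wf_digraph H.wf_digraph by (auto simp: subgraph_def compatible_def)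
    then show False using no_sub H by blast
  qed
  then have uvH: "u \<in> pverts H" "v \<in> pverts H"
    using H.wellformed' by auto
  define \<rho> where "\<rho> = (real k - 2 + sqrt (real k ^ 2 + 4 * real k - 4)) / 2"
  obtain c where c: "c \<ge> 1" "\<rho> * c = (real k - 2) * c + 2" "(real k - 1) * c = \<rho>"
    using extremal_weights[OF assms(1)] unfolding \<rho>_def .
  define x where "x = (\<lambda>w. if w = u \<or> w = v then 1 else if w \<in> pverts H then c else 0)"
  have x0: "x w \<ge> 0" for w
    using c(1) by (simp add: x_def)
  have fin: "finite (parcs G `` {w})" "finite (parcs H `` {w})" for w
    by (rule finite_subset[OF neighbours_subset_pverts pair_finite_verts, OF G])
      (rule finite_subset[OF neighbours_subset_pverts H.pair_finite_verts, OF H.pair_graph])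
  have deg: "real k \<le> card (parcs H `` {w})" if "w \<in> pverts H" for w
    using k_edge_connected_degree[OF H that] by simp
  \<comment> \<open>At \<open>u\<close> and \<open>v\<close> the edge \<open>uv\<close> of \<open>H\<close> is lost in \<open>G\<close>; the other neighbours all have weight \<open>c\<close>.\<close>
  have endpoint: "\<rho> \<le> (\<Sum>z\<in>parcs G `` {w}. x z)" if w: "w = u \<and> w' = v \<or> w = v \<and> w' = u" for w w'
  proof -
    have "\<rho> \<le> (real (card (parcs H `` {w})) - 1) * c"
      unfolding c(3)[symmetric]
      using deg[of w] uvH w c(1) by (intro mult_right_mono) auto
    also have "\<dots> \<le> card (parcs H `` {w} - {w'}) * c"
      using c(1) by (intro mult_right_mono) (auto simp: card_Diff_singleton_if)
    also have "\<dots> = (\<Sum>z\<in>parcs H `` {w} - {w'}. x z)"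
      using w H.no_loops' H.wellformed' by (subst sum.cong[OF refl, of _ x "\<lambda>_. c"]) (auto simp: x_def)
    also have "\<dots> \<le> (\<Sum>z\<in>parcs G `` {w}. x z)"
      using EH w x0 fin uv(3) by (intro sum_mono2) auto
    finally show ?thesis .
  qed
  have "\<rho> * x w \<le> (\<Sum>z\<in>parcs G `` {w}. x z)" if "w \<in> pverts G" for w
  proof -
    consider "w = u" | "w = v" | "w \<in> pverts H" "w \<noteq> u" "w \<noteq> v" | "w \<notin> pverts H"
      by blast
    then show ?thesis
    proof cases
      case 3
      let ?N = "parcs H `` {w}"
      have "card (?N \<inter> {u, v}) \<le> card {u, v}"
        by (intro card_mono) auto
      then have two: "card (?N \<inter> {u, v}) \<le> 2"
        using uv(3) by simp
      \<comment> \<open>Count every neighbour with weight \<open>c\<close> and take back the excess \<open>c - 1\<close> at \<open>u\<close> and \<open>v\<close>.\<close>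
      have "\<rho> * x w = real k * c - (c - 1) * 2"
        using 3 c(2) by (simp add: x_def algebra_simps)
      also have "\<dots> \<le> real (card ?N) * c - (c - 1) * real (card (?N \<inter> {u, v}))"
        using deg[OF 3(1)] c(1) two by (intro diff_mono mult_right_mono mult_left_mono) auto
      also have "\<dots> = (\<Sum>z\<in>?N. c) - (\<Sum>z\<in>?N \<inter> {u, v}. c - 1)"
        by simp
      also have "\<dots> = (\<Sum>z\<in>?N. c - (if z \<in> {u, v} then c - 1 else 0))"
        unfolding sum_subtractf[of "\<lambda>_. c" "\<lambda>z. if z \<in> {u, v} then c - 1 else 0"]
          sum.inter_restrict[OF fin(2)] ..
      also have "\<dots> = (\<Sum>z\<in>?N. x z)"
        using H.wellformed' by (intro sum.cong) (auto simp: x_def)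
      also have "\<dots> \<le> (\<Sum>z\<in>parcs G `` {w}. x z)"
        using EH 3 x0 fin by (intro sum_mono2) auto
      finally show ?thesis .
    next
      case 4
      then show ?thesis using uvH x0 by (auto simp: x_def intro!: sum_nonneg)
    qed (use endpoint[of u v] endpoint[of v u] in \<open>simp_all add: x_def\<close>)
  qed
  then have "\<rho> \<le> graph_spectral_radius G"
    using uv(1) x0 by (intro le_graph_spectral_radius[OF G, of x]) (auto simp: x_def)
  then show ?thesis by (simp add: \<rho>_def)
qed

lemma complete_minus_edgeE:
  assumes "complete_minus_edge n G"
  obtains u v where "pair_graph G" "card (pverts G) = n" "finite (pverts G)"
    "u \<in> pverts G" "v \<in> pverts G" "u \<noteq> v"
    "parcs G = {(x, y). x \<in> pverts G \<and> y \<in> pverts G \<and> x \<noteq> y \<and> {x, y} \<noteq> {u, v}}"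
proof -
  obtain K e where K: "complete_digraph n (with_proj K)" "e \<in> edge_set K" "G = delete_edges K {e}"
    using assms by (auto simp: complete_minus_edge_def)
  have fin: "finite (pverts K)" "card (pverts K) = n"
    and arcs: "parcs K = {(x, y). (x, y) \<in> pverts K \<times> pverts K \<and> x \<noteq> y}"
    using K(1) by (simp_all add: complete_digraph_pair_def)
  obtain u v where uv: "e = {u, v}" "(u, v) \<in> parcs K"
    using K(2) by (auto simp: edge_set_def)
  have VG: "pverts G = pverts K"
    and EG: "parcs G = {(x, y). x \<in> pverts G \<and> y \<in> pverts G \<and> x \<noteq> y \<and> {x, y} \<noteq> {u, v}}"
    using K(3) uv arcs by (auto simp: delete_edges_def)
  have "finite (parcs G)"
    by (rule finite_subset[of _ "pverts K \<times> pverts K"]) (use EG VG fin in auto)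
  then have "pair_graph G"
    using fin by unfold_locales (auto simp: VG EG symmetric_def insert_commute intro!: symI)
  then show ?thesis
    using that[of u v] fin VG EG uv(2) arcs by simp
qed

text \<open>
  A \<open>k\<close>-edge-connected subgraph has minimum degree at least \<open>k\<close>, so it needs \<open>k + 1\<close> vertices, hence all
  of them, among them \<open>u\<close>, which has only \<open>k - 1\<close> neighbours. The only missing edge completes the graph.
\<close>

lemma complete_minus_edge_saturated:
  assumes "k \<ge> 1" "complete_minus_edge (k + 1) G"
  shows "saturated (edge_connected_family k) G"
proof -
  obtain u v where G: "pair_graph G" "card (pverts G) = k + 1" "finite (pverts G)"
    and uv: "u \<in> pverts G" "v \<in> pverts G" "u \<noteq> v"
    and arcs: "parcs G = {(x, y). x \<in> pverts G \<and> y \<in> pverts G \<and> x \<noteq> y \<and> {x, y} \<noteq> {u, v}}"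
    using complete_minus_edgeE[OF assms(2)] .
  have "\<not> k_edge_connected k H" if sub: "subgraph (with_proj H) (with_proj G)" for H
  proof
    assume H: "k_edge_connected k H"
    interpret H: pair_graph H
      using H by (simp add: k_edge_connected_def)
    have VH: "pverts H \<subseteq> pverts G" and EH: "parcs H \<subseteq> parcs G"
      using sub by (auto simp: subgraph_def)
    obtain w where w: "w \<in> pverts H"
      using H by (force simp: k_edge_connected_def)
    have "parcs H `` {w} \<subseteq> pverts H - {w}"
      using H.wellformed' H.no_loops'[of w w] by auto
    then have "k \<le> card (pverts H - {w})"
      using k_edge_connected_degree[OF H w] H.pair_finite_verts
      by (meson card_mono finite_Diff order_trans)
    then have "card (pverts G) \<le> card (pverts H)"
      using w G(2) H.pair_finite_verts card_gt_0_iff[of "pverts H"] assms(1) by auto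
    then have "u \<in> pverts H"
      using VH G(3) uv(1) card_seteq by blast
    moreover have "parcs H `` {u} \<subseteq> pverts G - {u, v}"
      using EH arcs by auto
    ultimately have "k \<le> card (pverts G - {u, v})"
      using k_edge_connected_degree[OF H] G(3) by (meson card_mono finite_Diff order_trans)
    then show False
      using uv G assms(1) by (simp add: card_Diff_subset)
  qed
  moreover have "\<exists>H. subgraph (with_proj H) (with_proj (add_edge G x y)) \<and> k_edge_connected k H"
    if xy: "x \<in> pverts G" "y \<in> pverts G" "x \<noteq> y" "(x, y) \<notin> parcs G" for x y
  proof (intro exI conjI)
    have "{x, y} = {u, v}"
      using xy arcs by auto
    then have "parcs (add_edge G x y) = {(a, b). a \<in> pverts G \<and> b \<in> pverts G \<and> a \<noteq> b}"
      using uv xy(1-3) unfolding add_edge_def arcs by (auto simp: doubleton_eq_iff)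
    then show conn: "k_edge_connected k (add_edge G x y)"
      using G assms(1) by (intro complete_k_edge_connected) (simp_all add: add_edge_def)
    then interpret A: pair_graph "add_edge G x y"
      by (simp add: k_edge_connected_def)
    show "subgraph (with_proj (add_edge G x y)) (with_proj (add_edge G x y))"
      using A.wf_digraph by (auto simp: subgraph_def compatible_def)
  qed
  ultimately show ?thesis
    using G(1) by (auto simp: saturated_def edge_connected_family_def)
qed

text \<open>
  The extremal weights are all positive and satisfy the eigenvalue equation at every vertex, so they
  are a positive supersolution.
\<close>

lemma complete_minus_edge_spectral_bound:
  assumes "k \<ge> 1" "complete_minus_edge (k + 1) G"
  shows "graph_spectral_radius G \<le> (real k - 2 + sqrt (real k ^ 2 + 4 * real k - 4)) / 2"
proof -
  obtain u v where G: "pair_graph G" "card (pverts G) = k + 1" "finite (pverts G)"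
    and uv: "u \<in> pverts G" "v \<in> pverts G" "u \<noteq> v"
    and arcs: "parcs G = {(x, y). x \<in> pverts G \<and> y \<in> pverts G \<and> x \<noteq> y \<and> {x, y} \<noteq> {u, v}}"
    using complete_minus_edgeE[OF assms(2)] .
  define \<rho> where "\<rho> = (real k - 2 + sqrt (real k ^ 2 + 4 * real k - 4)) / 2"
  obtain c where c: "c \<ge> 1" "\<rho> * c = (real k - 2) * c + 2" "(real k - 1) * c = \<rho>"
    using extremal_weights[OF assms(1)] unfolding \<rho>_def .
  define z where "z = (\<lambda>w. if w = u \<or> w = v then 1 else c)"
  have const: "(\<Sum>y\<in>pverts G - A. z y) = real (card (pverts G - A)) * c" if "{u, v} \<subseteq> A" for A
    using that by (subst sum.cong[OF refl, of _ z "\<lambda>_. c"]) (auto simp: z_def)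
  have "graph_spectral_radius G \<le> \<rho>"
  proof (rule graph_spectral_radius_le[OF G(1)])
    fix w assume w: "w \<in> pverts G"
    show "z w > 0" using c(1) by (simp add: z_def)
    show "(\<Sum>y\<in>parcs G `` {w}. z y) \<le> \<rho> * z w"
    proof (cases "w \<in> {u, v}")
      case True
      have "parcs G `` {w} = pverts G - {u, v}"
        using True uv arcs by auto
      moreover have "real (card (pverts G - {u, v})) = real k - 1"
        using uv G assms(1) by (simp add: card_Diff_subset)
      ultimately show ?thesis
        using True c(3) by (simp add: const z_def)
    next
      case False
      have "card {u, v, w} \<le> card (pverts G)"
        using uv w G(3) by (intro card_mono) auto
      moreover have three: "card {u, v, w} = 3"
        using False uv(3) by auto
      ultimately have "k \<ge> 2"
        using G(2) by simp
      then have card: "real (card (pverts G - {u, v, w})) = real k - 2"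
        using uv w G three by (simp add: card_Diff_subset)
      have "parcs G `` {w} = {u, v} \<union> (pverts G - {u, v, w})"
        using False uv w arcs by auto
      then have "(\<Sum>y\<in>parcs G `` {w}. z y) = (\<Sum>y\<in>{u, v}. z y) + (\<Sum>y\<in>pverts G - {u, v, w}. z y)"
        by (simp only:) (rule sum.union_disjoint; use G(3) in auto)
      also have "(\<Sum>y\<in>{u, v}. z y) = 2"
        using uv(3) by (simp add: z_def)
      also have "(\<Sum>y\<in>pverts G - {u, v, w}. z y) = (real k - 2) * c"
        using const[of "{u, v, w}"] card by simp
      finally show ?thesis
        using False c(2) by (simp add: z_def)
    qed
  qed (use uv in auto)
  then show ?thesis by (simp add: \<rho>_def)
qed

theorem theorem4p4:
  fixes k :: nat
  assumes "k \<ge> 1"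
  shows "(\<forall>G :: 'a pair_pre_digraph.
            saturated (edge_connected_family k) G \<and> card (pverts G) \<ge> k + 1 \<longrightarrow>
            graph_spectral_radius G \<ge> (real k - 2 + sqrt (real k ^ 2 + 4 * real k - 4)) / 2) \<and>
         (\<forall>G :: 'a pair_pre_digraph.
            complete_minus_edge (k + 1) G \<longrightarrow>
            saturated (edge_connected_family k) G \<and> card (pverts G) = k + 1 \<and>
            graph_spectral_radius G = (real k - 2 + sqrt (real k ^ 2 + 4 * real k - 4)) / 2)"
proof (intro conjI allI impI)
  fix G :: "'a pair_pre_digraph"
  assume "saturated (edge_connected_family k) G \<and> card (pverts G) \<ge> k + 1"
  then show "graph_spectral_radius G \<ge> (real k - 2 + sqrt (real k ^ 2 + 4 * real k - 4)) / 2"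
    using saturated_spectral_bound[OF assms] by blast
next
  fix G :: "'a pair_pre_digraph"
  assume G: "complete_minus_edge (k + 1) G"
  show sat: "saturated (edge_connected_family k) G"
    using complete_minus_edge_saturated[OF assms G] .
  show card: "card (pverts G) = k + 1"
    using complete_minus_edgeE[OF G] by blast
  show "graph_spectral_radius G = (real k - 2 + sqrt (real k ^ 2 + 4 * real k - 4)) / 2"
    using complete_minus_edge_spectral_bound[OF assms G] saturated_spectral_bound[OF assms sat]
      card by (intro antisym) simp_all
qed

end
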